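(* Let $m \geq 6$ be an integer, and let $v=m^2(m-2)+4$ and $k=m(m-1)+2$. Then \[C(v,k,5) \geq L(v,k,5)+m(m-4)-10.\]
   Context: For positive integers $t,v,k$ with $t \leq k \leq v$, a $t$-$(v,k,1)$ covering is a pair $(V,\mathcal{B})$ where $V$ is a set of $v$ points and $\mathcal{B}$ is a multiset of $k$-subsets of $V$ (called blocks) such that each $t$-subset of $V$ is contained in at least one block in $\mathcal{B}$. The covering number $C(v,k,t)$ is the minimum number of blocks (counted with multiplicity) in any $t$-$(v,k,1)$ covering. The Schönheim bound is \[L(v,k,t) = \left\lceil\frac{v}{k} \left\lceil\frac{v-1}{k-1} \cdots \left\lceil\frac{v-t+2}{k-t+2} \left\lceil\frac{v-t+1}{k-t+1} \right\rceil \right\rceil \cdots \right\rceil \right\rceil.\] *)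

theory Defs
  imports Complex_Main "HOL-Library.Multiset"
begin

definition is_covering :: "nat \<Rightarrow> nat \<Rightarrow> nat \<Rightarrow> 'a set \<Rightarrow> 'a set multiset \<Rightarrow> bool" where
  "is_covering t v k V B \<longleftrightarrow>
     0 < t \<and> t \<le> k \<and> k \<le> v \<and>
     finite V \<and> card V = v \<and>
     (\<forall>b \<in># B. b \<subseteq> V \<and> card b = k) \<and>
     (\<forall>T. T \<subseteq> V \<and> card T = t \<longrightarrow> (\<exists>b \<in># B. T \<subseteq> b))"

text \<open>
  A minimum over all point sets cannot range over all types, so the points are taken to be
  natural numbers. Nothing is lost: \<open>covering_number_le\<close> below shows that this
  minimum bounds the coverings over every point type, and \<open>covering_number_attained\<close>
  that it is a genuine minimum.
\<close>

definition covering_number :: "nat \<Rightarrow> nat \<Rightarrow> nat \<Rightarrow> nat" where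
  "covering_number v k t =
     (LEAST n. \<exists>(V :: nat set) B. is_covering t v k V B \<and> size B = n)"

text \<open>
  The outermost factor of the nested product is peeled off first; for \<open>t \<le> k \<le> v\<close>
  the truncated subtraction is never applied to 0, and the innermost factor is
  \<open>\<lceil>(v - t + 1) / (k - t + 1)\<rceil>\<close>.
\<close>

fun schonheim_bound :: "nat \<Rightarrow> nat \<Rightarrow> nat \<Rightarrow> int" where
  "schonheim_bound v k 0 = 1"
| "schonheim_bound v k (Suc t) =
     \<lceil>real v / real k * of_int (schonheim_bound (v - 1) (k - 1) t)\<rceil>"

lemma is_covering_exists:
  assumes "0 < t" "t \<le> k" "k \<le> v"
  shows "\<exists>B. is_covering t v k {..<v} B"
proof -
  let ?V = "{..<v}"
  let ?S = "{b. b \<subseteq> ?V \<and> card b = k}"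
  have fin: "finite ?S" by simp
  have "\<exists>b \<in> ?S. T \<subseteq> b" if T: "T \<subseteq> ?V" "card T = t" for T
    using exists_subset_between[of T k ?V] T assms by auto
  then have "is_covering t v k ?V (mset_set ?S)"
    using assms fin unfolding is_covering_def by auto
  then show ?thesis ..
qed

lemma covering_number_attained:
  assumes "0 < t" "t \<le> k" "k \<le> v"
  shows "\<exists>(V :: nat set) B. is_covering t v k V B \<and> size B = covering_number v k t"
  unfolding covering_number_def
  by (rule LeastI_ex) (use is_covering_exists[OF assms] in blast)

lemma is_covering_image:
  assumes cov: "is_covering t v k V B" and inj: "inj_on f V"
  shows "is_covering t v k (f ` V) (image_mset ((`) f) B)"
proof -
  have "\<exists>b \<in># B. T \<subseteq> f ` b" if T: "T \<subseteq> f ` V" "card T = t" for T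
  proof -
    obtain U where U: "U \<subseteq> V" "T = f ` U"
      using T(1) by (auto simp: subset_image_iff)
    then have "card U = t"
      using T(2) inj by (metis card_image inj_on_subset)
    then obtain b where "b \<in># B" "U \<subseteq> b"
      using cov U(1) unfolding is_covering_def by blast
    then show ?thesis using U(2) by blast
  qed
  moreover have "card (f ` b) = k \<and> f ` b \<subseteq> f ` V" if "b \<in># B" for b
    using that cov inj unfolding is_covering_def
    by (metis card_image image_mono inj_on_subset)
  moreover have "card (f ` V) = v"
    using cov inj unfolding is_covering_def by (metis card_image)
  ultimately show ?thesis
    using cov unfolding is_covering_def by auto
qed

lemma covering_number_le:
  fixes V :: "'a set"
  assumes "is_covering t v k V B"
  shows "covering_number v k t \<le> size B"
proof -
  have "finite V" using assms unfolding is_covering_def by blast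
  then obtain f :: "'a \<Rightarrow> nat" where "inj_on f V"
    using finite_imp_inj_to_nat_seg by blast
  then have "is_covering t v k (f ` V) (image_mset ((`) f) B)"
    using assms by (rule is_covering_image[rotated])
  then show ?thesis
    unfolding covering_number_def by (intro Least_le exI conjI) auto
qed

end

theory Submission
  imports Defs
begin

text \<open>
  The parameters are chosen so that all the divisions in the Schonheim argument are exact in
  the middle levels. In a \<open>5\<close>-covering with these \<open>v\<close> and \<open>k\<close>, a set of four points lies in
  at least \<open>m\<close> blocks, hence a triple in at least \<open>m (m - 1)\<close> and a pair in at least \<open>v - 2\<close>,
  and the last two bounds follow from the first without any rounding.
  So if a pair lies in exactly \<open>v - 2\<close> blocks, every triple and every quadruple containing it
  also meets its bound with equality (\<open>deg_tight_step\<close>).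

  Call such a pair tight. For tight pairs \<open>P\<close> and \<open>Q\<close>, the number of blocks containing
  \<open>P \<union> Q\<close> depends only on \<open>card (P \<inter> Q)\<close>, just as in a \<open>4\<close>-design. As in the proofs of
  Fisher's inequality by Bose and of its generalisation by Wilson, the Gram matrix of the
  incidence vectors of the tight pairs is then positive definite, so these vectors are linearly
  independent and there are at most as many tight pairs as blocks
  (\<open>positive_definite_family_bound\<close>). There are far more pairs than blocks, so most
  pairs are in at least \<open>v - 1\<close> blocks. Counting incidences of pairs with the \<open>b\<close> blocks gives
  \<open>(v - 1) * (v choose 2) \<le> b * ((k choose 2) + 1)\<close> (\<open>fisher_bound_pairs\<close>), where the
  Schonheim argument gives \<open>(v - 2) * (v choose 2) \<le> b * (k choose 2)\<close> up to rounding. Since \<open>b\<close>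
  is of order \<open>m ^ 5\<close> and \<open>v\<close> of order \<open>m ^ 3\<close>, the gain is of order \<open>m ^ 2\<close>.

  The gain is so close to \<open>m (m - 4) - 10\<close> that the two outermost ceilings of the Schonheim
  bound have to be evaluated exactly. They are polynomials in \<open>m\<close> for \<open>m \<ge> 14\<close>, and numbers in
  the eight remaining cases.
\<close>

section \<open>Underdetermined linear systems\<close>

lemma homogeneous_system_nontrivial_solution:
  fixes a :: "'i \<Rightarrow> 'p \<Rightarrow> real"
  assumes "finite I" "finite S" "card I < card S"
  shows "\<exists>c. (\<exists>p\<in>S. c p \<noteq> 0) \<and> (\<forall>i\<in>I. (\<Sum>p\<in>S. a i p * c p) = 0)"
  using assms
proof (induction I arbitrary: S a rule: finite_induct)
  case empty
  then obtain p where "p \<in> S" by (metis card.empty equals0I less_irrefl)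
  then show ?case by (intro exI[of _ "\<lambda>_. 1"]) auto
next
  case (insert i I)
  show ?case
  proof (cases "\<forall>p\<in>S. a i p = 0")
    case True
    obtain c where "\<exists>p\<in>S. c p \<noteq> 0" "\<forall>j\<in>I. (\<Sum>p\<in>S. a j p * c p) = 0"
      using insert.IH[of S a] insert.prems insert.hyps by auto
    with True show ?thesis by (intro exI[of _ c]) auto
  next
    case False
    then obtain q where q: "q \<in> S" "a i q \<noteq> 0" by blast
    define a' where "a' j p = a j p - a j q * a i p / a i q" for j p
    have "card I < card (S - {q})" using insert.prems insert.hyps q by simp
    then obtain c where c: "\<exists>p\<in>S - {q}. c p \<noteq> 0"
      "\<forall>j\<in>I. (\<Sum>p\<in>S - {q}. a' j p * c p) = 0"
      using insert.IH[of "S - {q}" a'] insert.prems by blast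
    \<comment> \<open>Solve equation \<open>i\<close> for the unknown \<open>q\<close>.\<close>
    define c' where
      "c' = c(q := - (\<Sum>p\<in>S - {q}. a i p * c p) / a i q)"
    have split: "(\<Sum>p\<in>S. a j p * c' p) =
        a j q * c' q + (\<Sum>p\<in>S - {q}. a j p * c p)" for j
    proof -
      have "(\<Sum>p\<in>S - {q}. a j p * c' p) = (\<Sum>p\<in>S - {q}. a j p * c p)"
        by (rule sum.cong) (auto simp: c'_def)
      then show ?thesis
        using sum.remove[OF insert.prems(1) q(1), of "\<lambda>p. a j p * c' p"] by simp
    qed
    have "(\<Sum>p\<in>S. a j p * c' p) = 0" if "j \<in> I" for j
    proof -
      have "(\<Sum>p\<in>S - {q}. a' j p * c p) =
          (\<Sum>p\<in>S - {q}. a j p * c p - a j q / a i q * (a i p * c p))"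
        by (rule sum.cong) (auto simp: a'_def field_simps)
      then have "(\<Sum>p\<in>S - {q}. a j p * c p) = a j q / a i q * (\<Sum>p\<in>S - {q}. a i p * c p)"
        using c(2) that by (simp add: sum_subtractf sum_distrib_left)
      then show ?thesis unfolding split by (simp add: c'_def)
    qed
    moreover have "(\<Sum>p\<in>S. a i p * c' p) = 0"
      unfolding split using q by (simp add: c'_def)
    moreover have "\<exists>p\<in>S. c' p \<noteq> 0" using c(1) by (auto simp: c'_def)
    ultimately show ?thesis by (intro exI[of _ c']) auto
  qed
qed

section \<open>Degrees in a uniform family of blocks\<close>

text \<open>
  Blocks are indexed so that repeated blocks count separately.
\<close>

locale uniform_family =
  fixes V :: "'a set" and I :: "'i set" and A :: "'i \<Rightarrow> 'a set" and k :: nat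
  assumes finite_points: "finite V"
    and finite_index: "finite I"
    and block_subset: "i \<in> I \<Longrightarrow> A i \<subseteq> V"
    and block_card: "i \<in> I \<Longrightarrow> card (A i) = k"
begin

definition deg :: "'a set \<Rightarrow> nat" where
  "deg S = card {i \<in> I. S \<subseteq> A i}"

lemma finite_block: "i \<in> I \<Longrightarrow> finite (A i)"
  using block_subset finite_points finite_subset by blast

lemma sum_deg_extensions:
  assumes "finite S"
  shows "(\<Sum>x\<in>V - S. deg (insert x S)) = deg S * (k - card S)"
proof -
  have "card {x \<in> V - S. x \<in> A i} = k - card S" if "i \<in> {i \<in> I. S \<subseteq> A i}" for i
  proof -
    have "{x \<in> V - S. x \<in> A i} = A i - S" using that block_subset by auto
    then show ?thesis using that assms by (simp add: card_Diff_subset block_card)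
  qed
  then have "(\<Sum>x\<in>V - S. card {i \<in> {i \<in> I. S \<subseteq> A i}. x \<in> A i}) =
      (\<Sum>i\<in>{i \<in> I. S \<subseteq> A i}. k - card S)"
    using finite_points finite_index by (intro sum_multicount_gen) auto
  moreover have "{i \<in> {i \<in> I. S \<subseteq> A i}. x \<in> A i} = {i \<in> I. insert x S \<subseteq> A i}" for x
    by auto
  ultimately show ?thesis by (simp add: deg_def)
qed

lemma sum_deg_subsets:
  "(\<Sum>S\<in>{S. S \<subseteq> V \<and> card S = s}. deg S) = card I * (k choose s)"
proof -
  have "card {S \<in> {S. S \<subseteq> V \<and> card S = s}. S \<subseteq> A i} = k choose s" if "i \<in> I" for i
  proof -
    have "{S \<in> {S. S \<subseteq> V \<and> card S = s}. S \<subseteq> A i} = {S. S \<subseteq> A i \<and> card S = s}"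
      using that block_subset by blast
    then show ?thesis using that by (simp add: n_subsets finite_block block_card)
  qed
  then have "(\<Sum>S\<in>{S. S \<subseteq> V \<and> card S = s}. card {i \<in> I. S \<subseteq> A i}) = (\<Sum>i\<in>I. k choose s)"
    using finite_points finite_index by (intro sum_multicount_gen) auto
  then show ?thesis by (simp add: deg_def)
qed

text \<open>
  One level of the Schonheim argument. The right-hand side is the number of pairs of a point
  outside \<open>S\<close> and a block containing it together with \<open>S\<close>.
\<close>

lemma deg_lower_step:
  assumes "S \<subseteq> V" and "\<And>x. x \<in> V - S \<Longrightarrow> l \<le> deg (insert x S)"
  shows "l * (card V - card S) \<le> deg S * (k - card S)"
proof -
  have fin: "finite S" using assms(1) finite_points finite_subset by blast
  have "l * (card V - card S) = (\<Sum>x\<in>V - S. l)"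
    using assms(1) fin by (simp add: card_Diff_subset)
  also have "\<dots> \<le> (\<Sum>x\<in>V - S. deg (insert x S))"
    using assms(2) by (intro sum_mono)
  finally show ?thesis using sum_deg_extensions[OF fin] by simp
qed

lemma deg_tight_step:
  assumes "S \<subseteq> V" and ge: "\<And>x. x \<in> V - S \<Longrightarrow> l \<le> deg (insert x S)"
    and eq: "deg S * (k - card S) = l * (card V - card S)"
    and x: "x \<in> V - S"
  shows "deg (insert x S) = l"
proof (rule ccontr)
  have fin: "finite S" using assms(1) finite_points finite_subset by blast
  assume "deg (insert x S) \<noteq> l"
  then have "l < deg (insert x S)" using ge[OF x] by simp
  then have "(\<Sum>x\<in>V - S. l) < (\<Sum>x\<in>V - S. deg (insert x S))"
    using x ge finite_points by (intro sum_strict_mono_ex1) auto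
  then show False
    using sum_deg_extensions[OF fin] eq assms(1) fin by (simp add: card_Diff_subset)
qed

section \<open>A Fisher inequality for pairs\<close>

text \<open>
  If there were more members of \<open>\<P>\<close> than blocks, some nontrivial combination \<open>c\<close> of their
  incidence vectors would vanish. Its squared norm is the quadratic form of the matrix of
  degrees \<open>deg (P \<union> Q)\<close>, and by assumption this matrix is the sum of a nonnegative multiple of
  the all-ones matrix, a nonnegative multiple of the Gram matrix of the sets themselves, and a
  positive multiple of the identity. So the norm is at least \<open>\<gamma> * (\<Sum>P\<in>\<P>. (c P)\<^sup>2)\<close>, which is
  positive.
\<close>

lemma positive_definite_family_bound:
  fixes \<alpha> \<beta> \<gamma> :: real
  assumes sub: "\<P> \<subseteq> Pow V"
    and coeff: "\<alpha> \<ge> 0" "\<beta> \<ge> 0" "\<gamma> > 0"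
    and gram: "\<And>P Q. P \<in> \<P> \<Longrightarrow> Q \<in> \<P> \<Longrightarrow>
      real (deg (P \<union> Q)) = \<alpha> + \<beta> * real (card (P \<inter> Q)) + \<gamma> * of_bool (P = Q)"
  shows "card \<P> \<le> card I"
proof (rule ccontr)
  assume "\<not> ?thesis"
  moreover have fin: "finite \<P>" using sub finite_points finite_subset by auto
  ultimately obtain c where c: "\<exists>P\<in>\<P>. c P \<noteq> 0"
    "\<And>i. i \<in> I \<Longrightarrow> (\<Sum>P\<in>\<P>. of_bool (P \<subseteq> A i) * c P) = (0 :: real)"
    using homogeneous_system_nontrivial_solution[OF finite_index, of \<P>
        "\<lambda>i P. of_bool (P \<subseteq> A i)"]
    by (auto simp: not_le)
  \<comment> \<open>Both the degree of a union and the size of an intersection are inner products of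
    incidence vectors, over the blocks and over the points respectively.\<close>
  have square: "(\<Sum>P\<in>\<P>. \<Sum>Q\<in>\<P>. c P * c Q * real (card {x \<in> X. R P x \<and> R Q x})) =
      (\<Sum>x\<in>X. (\<Sum>P\<in>\<P>. of_bool (R P x) * c P)\<^sup>2)"
    if "finite X" for X :: "'x set" and R
  proof -
    have "real (card {x \<in> X. R P x \<and> R Q x}) =
        (\<Sum>x\<in>X. of_bool (R P x) * of_bool (R Q x))" for P Q
    proof -
      have "(\<Sum>x\<in>X. of_bool (R P x) * of_bool (R Q x)) =
          (\<Sum>x\<in>X. of_bool (R P x \<and> R Q x) :: real)"
        by (rule sum.cong) auto
      then show ?thesis using that by (simp add: Int_def)
    qed
    then have "(\<Sum>P\<in>\<P>. \<Sum>Q\<in>\<P>. c P * c Q * real (card {x \<in> X. R P x \<and> R Q x})) =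
        (\<Sum>P\<in>\<P>. \<Sum>Q\<in>\<P>. \<Sum>x\<in>X. (of_bool (R P x) * c P) * (of_bool (R Q x) * c Q))"
      by (simp add: sum_distrib_left mult_ac)
    also have "\<dots> = (\<Sum>P\<in>\<P>. \<Sum>x\<in>X. \<Sum>Q\<in>\<P>. (of_bool (R P x) * c P) * (of_bool (R Q x) * c Q))"
      by (intro sum.cong refl sum.swap)
    also have "\<dots> = (\<Sum>x\<in>X. \<Sum>P\<in>\<P>. \<Sum>Q\<in>\<P>. (of_bool (R P x) * c P) * (of_bool (R Q x) * c Q))"
      by (rule sum.swap)
    finally show ?thesis by (simp add: power2_eq_square sum_product)
  qed
  have "(\<Sum>P\<in>\<P>. \<Sum>Q\<in>\<P>. c P * c Q * real (deg (P \<union> Q))) = 0"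
    using square[OF finite_index, of "\<lambda>P i. P \<subseteq> A i"] c(2) by (simp add: deg_def)
  moreover have "(\<Sum>P\<in>\<P>. \<Sum>Q\<in>\<P>. c P * c Q * real (deg (P \<union> Q))) =
      \<alpha> * ((\<Sum>P\<in>\<P>. c P) * (\<Sum>P\<in>\<P>. c P)) + \<beta> * (\<Sum>P\<in>\<P>. \<Sum>Q\<in>\<P>. c P * c Q * real (card (P \<inter> Q))) +
      \<gamma> * (\<Sum>P\<in>\<P>. (c P)\<^sup>2)"
  proof -
    have "(\<Sum>P\<in>\<P>. \<Sum>Q\<in>\<P>. c P * c Q * real (deg (P \<union> Q))) =
        (\<Sum>P\<in>\<P>. \<Sum>Q\<in>\<P>. \<alpha> * (c P * c Q) + \<beta> * (c P * c Q * real (card (P \<inter> Q))) +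
          (if P = Q then \<gamma> * (c P * c Q) else 0))"
      by (intro sum.cong refl) (auto simp: gram algebra_simps)
    then show ?thesis
      unfolding sum_product
      using fin by (simp add: sum.distrib sum_distrib_left power2_eq_square)
  qed
  moreover have "(\<Sum>P\<in>\<P>. \<Sum>Q\<in>\<P>. c P * c Q * real (card (P \<inter> Q))) \<ge> 0"
  proof -
    have "P \<inter> Q = {x \<in> V. x \<in> P \<and> x \<in> Q}" if "P \<in> \<P>" for P Q
      using that sub by auto
    then have "(\<Sum>P\<in>\<P>. \<Sum>Q\<in>\<P>. c P * c Q * real (card (P \<inter> Q))) =
        (\<Sum>x\<in>V. (\<Sum>P\<in>\<P>. of_bool (x \<in> P) * c P)\<^sup>2)"
      using square[OF finite_points, of "\<lambda>P x. x \<in> P"] by simp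
    then show ?thesis by (simp add: sum_nonneg)
  qed
  moreover have "(\<Sum>P\<in>\<P>. (c P)\<^sup>2) > 0"
    using c(1) fin by (auto intro!: sum_pos2)
  ultimately show False
    using mult_nonneg_nonneg[OF coeff(1) zero_le_square[of "\<Sum>P\<in>\<P>. c P"]]
      mult_nonneg_nonneg[OF coeff(2)] mult_pos_pos[OF coeff(3)]
    by fastforce
qed

text \<open>
  The two equations leave nothing to round in passing from quadruples to triples and from
  triples to pairs, so a pair of degree \<open>l2\<close> forces equality at all the triples and
  quadruples above it. Such pairs satisfy the hypothesis of
  \<open>positive_definite_family_bound\<close> with \<open>\<alpha> = l4\<close>, \<open>\<beta> = l3 - l4\<close> and \<open>\<gamma> = l2 + l4 - 2 * l3\<close>:
  these are the values for which \<open>\<alpha>\<close>, \<open>\<alpha> + \<beta>\<close> and \<open>\<alpha> + 2 * \<beta> + \<gamma>\<close> are the degrees \<open>l4\<close>,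
  \<open>l3\<close> and \<open>l2\<close>. All other pairs have degree at least \<open>l2 + 1\<close>.
\<close>

lemma fisher_bound_pairs:
  fixes l2 l3 l4 :: nat
  assumes "3 < k" "k \<le> card V"
    and deg4: "\<And>S. S \<subseteq> V \<Longrightarrow> card S = 4 \<Longrightarrow> l4 \<le> deg S"
    and l3: "l3 * (k - 3) = l4 * (card V - 3)"
    and l2: "l2 * (k - 2) = l3 * (card V - 2)"
    and convex: "2 * l3 < l2 + l4"
  shows "(l2 + 1) * (card V choose 2) \<le> card I * ((k choose 2) + 1)"
proof -
  have deg3: "l3 \<le> deg S" if S: "S \<subseteq> V" "card S = 3" for S
  proof -
    have "finite S" using S by (simp add: card_ge_0_finite)
    then have "l4 \<le> deg (insert x S)" if "x \<in> V - S" for x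
      using that S deg4[of "insert x S"] by simp
    from deg_lower_step[OF S(1) this] show ?thesis
      using S l3 \<open>3 < k\<close> by (metis mult_le_cancel2 zero_less_diff)
  qed
  have ext3: "l3 \<le> deg (insert x S)" if "S \<subseteq> V" "card S = 2" "x \<in> V - S" for S x
    using that deg3[of "insert x S"] by (simp add: card_ge_0_finite)
  have deg2: "l2 \<le> deg S" if S: "S \<subseteq> V" "card S = 2" for S
  proof -
    from deg_lower_step[OF S(1) ext3[OF S]] show ?thesis
      using S l2 \<open>3 < k\<close> by (metis mult_le_cancel2 zero_less_diff Suc_lessD eval_nat_numeral(3))
  qed
  have "l4 \<le> l3"
  proof -
    have "l4 * (k - 3) \<le> l4 * (card V - 3)" using assms(2) by (intro mult_le_mono) auto
    then show ?thesis using l3 \<open>3 < k\<close> by (metis mult_le_cancel2 zero_less_diff)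
  qed
  define Pairs where "Pairs = {S. S \<subseteq> V \<and> card S = 2}"
  define Tight where "Tight = {S \<in> Pairs. deg S = l2}"
  have tight3: "deg (insert x P) = l3" if "P \<in> Tight" "x \<in> V - P" for P x
    using that ext3 l2 by (intro deg_tight_step) (auto simp: Tight_def Pairs_def)
  have tight4: "deg (insert y (insert x P)) = l4"
    if P: "P \<in> Tight" and x: "x \<in> V - P" and y: "y \<in> V - insert x P" for P x y
  proof (rule deg_tight_step)
    have card: "card (insert x P) = 3" and fin: "finite P"
      using P x by (auto simp: Tight_def Pairs_def card_ge_0_finite)
    show "insert x P \<subseteq> V" using P x by (auto simp: Tight_def Pairs_def)
    show "deg (insert x P) * (k - card (insert x P)) = l4 * (card V - card (insert x P))"
      using tight3[OF P x] card l3 by simp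
    show "l4 \<le> deg (insert z (insert x P))" if "z \<in> V - insert x P" for z
      using that card fin P x by (intro deg4) (auto simp: Tight_def Pairs_def)
  qed fact
  have gram: "real (deg (P \<union> Q)) = real l4 + real (l3 - l4) * real (card (P \<inter> Q)) +
      real (l2 + l4 - 2 * l3) * of_bool (P = Q)"
    if P: "P \<in> Tight" and Q: "Q \<in> Tight" for P Q
  proof -
    obtain x y where xy: "Q = {x, y}" "x \<noteq> y" "x \<in> V" "y \<in> V"
      using Q by (auto simp: Tight_def Pairs_def card_2_iff)
    have P2: "card P = 2" "finite P" "deg P = l2"
      using P by (auto simp: Tight_def Pairs_def card_ge_0_finite)
    consider "x \<in> P" "y \<in> P" | "x \<in> P" "y \<notin> P" | "x \<notin> P" "y \<in> P" | "x \<notin> P" "y \<notin> P"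
      by blast
    then show ?thesis
    proof cases
      case 1
      then have "P = Q"
        using xy P2 by (metis card_2_iff card_subset_eq empty_subsetI insert_subset)
      then show ?thesis using P2 \<open>l4 \<le> l3\<close> convex by (simp add: of_nat_diff)
    next
      case 2
      then have "P \<union> Q = insert y P" "P \<inter> Q = {x}" "P \<noteq> Q" using xy by auto
      then show ?thesis using tight3[OF P, of y] 2 xy \<open>l4 \<le> l3\<close> by (simp add: of_nat_diff)
    next
      case 3
      then have "P \<union> Q = insert x P" "P \<inter> Q = {y}" "P \<noteq> Q" using xy by auto
      then show ?thesis using tight3[OF P, of x] 3 xy \<open>l4 \<le> l3\<close> by (simp add: of_nat_diff)
    next
      case 4
      then have "P \<union> Q = insert y (insert x P)" "P \<inter> Q = {}" "P \<noteq> Q" using xy by auto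
      then show ?thesis using tight4[OF P, of x y] 4 xy by simp
    qed
  qed
  have few: "card Tight \<le> card I"
    by (rule positive_definite_family_bound[OF _ _ _ _ gram])
      (use convex in \<open>auto simp: Tight_def Pairs_def\<close>)
  have fin: "finite Pairs" using finite_points by (simp add: Pairs_def)
  have "(l2 + 1) * card Pairs = (\<Sum>P\<in>Pairs. l2 + 1)" by simp
  also have "\<dots> \<le> (\<Sum>P\<in>Pairs. deg P + of_bool (P \<in> Tight))"
  proof (rule sum_mono)
    fix P assume "P \<in> Pairs"
    then show "l2 + 1 \<le> deg P + of_bool (P \<in> Tight)"
      using deg2[of P] by (auto simp: Tight_def Pairs_def)
  qed
  also have "\<dots> = card I * (k choose 2) + card Tight"
  proof -
    have "Pairs \<inter> Tight = Tight" by (auto simp: Tight_def)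
    then show ?thesis
      using fin sum_deg_subsets[of 2] by (simp add: sum.distrib Pairs_def[symmetric])
  qed
  finally show ?thesis
    using few n_subsets[OF finite_points, of 2] by (simp add: Pairs_def)
qed

end

section \<open>Comparison with the Schonheim bound\<close>

text \<open>
  The bound for pairs applies with degrees \<open>m\<close>, \<open>m (m - 1)\<close> and \<open>v - 2\<close> because
  \<open>v - 3 = (m - 1) (k - 3)\<close> and \<open>k - 2 = m (m - 1)\<close>. Only the passage from \<open>5\<close>-sets to
  quadruples rounds: \<open>(v - 4) / (k - 4)\<close> lies strictly between \<open>m - 1\<close> and \<open>m\<close>.
\<close>

lemma covering_size_bound:
  fixes m :: nat
  assumes "m \<ge> 4"
    and v: "v = m\<^sup>2 * (m - 2) + 4"
    and k: "k = m * (m - 1) + 2"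
    and cov: "is_covering 5 v k V B"
  shows "v * (v - 1) * (v - 1) \<le> size B * (k * (k - 1) + 2)"
proof -
  obtain xs where xs: "mset xs = B" using ex_mset by blast
  have elem: "xs ! i \<in># B" if "i < length xs" for i using that xs by auto
  interpret uniform_family V "{..<length xs}" "\<lambda>i. xs ! i" k
    using cov elem by unfold_locales (auto simp: is_covering_def)
  have card_V: "card V = v" using cov by (simp add: is_covering_def)
  obtain j where j: "m = j + 4" using \<open>m \<ge> 4\<close> by (metis add.commute le_Suc_ex)
  \<comment> \<open>Polynomials in \<open>j\<close> with nonnegative coefficients avoid truncated subtraction.\<close>
  have v_j: "v = j^3 + 10*j^2 + 32*j + 36" and k_j: "k = j^2 + 7*j + 14"
    unfolding v k j by (auto simp: algebra_simps power2_eq_square power3_eq_cube)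
  have k2: "k - 2 = j^2 + 7*j + 12" and k3: "k - 3 = j^2 + 7*j + 11"
    and k4: "k - 4 = j^2 + 7*j + 10"
    and v2: "v - 2 = j^3 + 10*j^2 + 32*j + 34" and v3: "v - 3 = j^3 + 10*j^2 + 32*j + 33"
    and v4: "v - 4 = j^3 + 10*j^2 + 32*j + 32"
    using v_j k_j by auto
  have deg5: "1 \<le> deg S" if "S \<subseteq> V" "card S = 5" for S
  proof -
    obtain b where "b \<in># B" "S \<subseteq> b" using cov \<open>S \<subseteq> V\<close> \<open>card S = 5\<close> by (auto simp: is_covering_def)
    then obtain i where "i < length xs" "S \<subseteq> xs ! i"
      using xs by (metis in_set_conv_nth set_mset_mset)
    then have "{i \<in> {..<length xs}. S \<subseteq> xs ! i} \<noteq> {}" by auto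
    then have "card {i \<in> {..<length xs}. S \<subseteq> xs ! i} \<noteq> 0" by (subst card_0_eq) auto
    then show ?thesis unfolding deg_def by linarith
  qed
  have deg4: "m \<le> deg S" if S: "S \<subseteq> V" "card S = 4" for S
  proof (rule ccontr)
    assume "\<not> m \<le> deg S"
    then have le: "deg S \<le> j + 3" using j by simp
    have "1 \<le> deg (insert x S)" if "x \<in> V - S" for x
      using that S deg5[of "insert x S"] by (simp add: card_ge_0_finite)
    from deg_lower_step[OF S(1) this] have "v - 4 \<le> deg S * (k - 4)"
      using S card_V by simp
    also have "\<dots> \<le> (j + 3) * (k - 4)" using le by (rule mult_right_mono) simp
    finally show False
      unfolding v4 k4 by (simp add: algebra_simps power2_eq_square power3_eq_cube)
  qed
  have "(v - 2 + 1) * (card V choose 2) \<le> card {..<length xs} * ((k choose 2) + 1)"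
  proof (rule fisher_bound_pairs[OF _ _ deg4])
    show "3 < k" "k \<le> card V" unfolding card_V k_j v_j by auto
    show "m * (m - 1) * (k - 3) = m * (card V - 3)"
      unfolding card_V v3 k3 j by (simp add: algebra_simps power2_eq_square power3_eq_cube)
    show "(v - 2) * (k - 2) = m * (m - 1) * (card V - 2)"
      unfolding card_V v2 k2 j by (simp add: algebra_simps power2_eq_square power3_eq_cube)
    show "2 * (m * (m - 1)) < v - 2 + m"
      unfolding v2 j by (simp add: algebra_simps power2_eq_square power3_eq_cube)
  qed
  then have "(v - 1) * (2 * (v choose 2)) \<le> size B * (2 * (k choose 2) + 2)"
    using card_V xs v_j by (auto simp: algebra_simps)
  moreover have "2 * (n choose 2) = n * (n - 1)" for n :: nat
    unfolding choose_two by (rule dvd_mult_div_cancel) (cases n, auto)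
  ultimately show ?thesis by (simp add: algebra_simps)
qed

lemma schonheim_bound_Suc_le:
  assumes "schonheim_bound (v - 1) (k - 1) t \<le> y" "0 < k" "int v * y \<le> int k * z"
  shows "schonheim_bound v k (Suc t) \<le> z"
proof -
  have "real v * real_of_int (schonheim_bound (v - 1) (k - 1) t) \<le> real v * real_of_int y"
    using assms(1) by (intro mult_left_mono) auto
  also have "\<dots> \<le> real k * real_of_int z"
    using assms(3) by (metis of_int_le_iff of_int_mult of_int_of_nat_eq)
  finally show ?thesis
    using assms(2) by (simp add: ceiling_le_iff field_simps)
qed

text \<open>
  Each \<open>y\<close> bounds one ceiling, starting from the innermost, and is an upper bound as soon as it
  is an integer above the quotient that is rounded.
\<close>

lemma schonheim_bound_5_le:
  fixes y1 y2 y3 y4 y5 :: int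
  assumes "5 \<le> k" "k \<le> v"
    and "int v - 4 \<le> (int k - 4) * y1"
    and "(int v - 3) * y1 \<le> (int k - 3) * y2"
    and "(int v - 2) * y2 \<le> (int k - 2) * y3"
    and "(int v - 1) * y3 \<le> (int k - 1) * y4"
    and "int v * y4 \<le> int k * y5"
  shows "schonheim_bound v k 5 \<le> y5"
proof -
  have s1: "schonheim_bound (v - 4) (k - 4) (Suc 0) \<le> y1"
    by (rule schonheim_bound_Suc_le[where y = 1]) (use assms in \<open>auto simp: of_nat_diff\<close>)
  have s2: "schonheim_bound (v - 3) (k - 3) (Suc (Suc 0)) \<le> y2"
    by (rule schonheim_bound_Suc_le[where y = y1])
      (use assms s1 in \<open>auto simp: of_nat_diff simp del: schonheim_bound.simps\<close>)
  have s3: "schonheim_bound (v - 2) (k - 2) (Suc (Suc (Suc 0))) \<le> y3"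
    by (rule schonheim_bound_Suc_le[where y = y2])
      (use assms s2 in \<open>auto simp: of_nat_diff simp del: schonheim_bound.simps\<close>)
  have s4: "schonheim_bound (v - 1) (k - 1) (Suc (Suc (Suc (Suc 0)))) \<le> y4"
    by (rule schonheim_bound_Suc_le[where y = y3])
      (use assms s3 in \<open>auto simp: of_nat_diff numeral_2_eq_2 simp del: schonheim_bound.simps\<close>)
  have "schonheim_bound v k (Suc (Suc (Suc (Suc (Suc 0))))) \<le> y5"
    by (rule schonheim_bound_Suc_le[where y = y4])
      (use assms s4 in \<open>auto simp del: schonheim_bound.simps\<close>)
  then show ?thesis by (simp only: numeral_eq_Suc pred_numeral_simps arith_simps BitM.simps)
qed

text \<open>
  The three inner ceilings are bounded by \<open>m\<close>, \<open>m (m - 1)\<close> and \<open>v - 2\<close>; candidates \<open>y4\<close> and \<open>y5\<close>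
  for the two outer ones remain to be supplied. As all quantities are integers, it suffices that
  a covering with one block fewer than claimed would violate the size bound; hence the \<open>11\<close>.
\<close>

lemma size_exceeds_schonheim_bound:
  fixes m :: nat and y4 y5 b M V K :: int
  defines "M \<equiv> int m"
  defines "V \<equiv> M ^ 3 - 2 * M\<^sup>2 + 4" and "K \<equiv> M\<^sup>2 - M + 2"
  assumes "m \<ge> 4"
    and v: "v = m\<^sup>2 * (m - 2) + 4" and k: "k = m * (m - 1) + 2"
    and size: "V * (V - 1)\<^sup>2 \<le> b * (K * (K - 1) + 2)"
    and y4: "(V - 1) * (V - 2) \<le> (K - 1) * y4"
    and y5: "V * y4 \<le> K * y5"
    and gap: "(y5 + M * (M - 4) - 11) * (K * (K - 1) + 2) < V * (V - 1)\<^sup>2"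
  shows "schonheim_bound v k 5 + M * (M - 4) - 10 \<le> b"
proof -
  obtain j where j: "m = j + 4" using \<open>m \<ge> 4\<close> by (metis add.commute le_Suc_ex)
  have M: "M = int j + 4" by (simp add: M_def j)
  have vV: "int v = V" and kK: "int k = K"
    unfolding v k V_def K_def M j by (auto simp: algebra_simps power2_eq_square power3_eq_cube)
  have "schonheim_bound v k 5 \<le> y5"
  proof (rule schonheim_bound_5_le[where ?y1.0 = M and ?y2.0 = "M * (M - 1)"
        and ?y3.0 = "V - 2" and ?y4.0 = y4])
    show "5 \<le> k" "k \<le> v"
      unfolding v k j by (auto simp: algebra_simps power2_eq_square)
    show "int v - 4 \<le> (int k - 4) * M"
      unfolding vV kK V_def K_def M by (simp add: algebra_simps power2_eq_square power3_eq_cube)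
    show "(int v - 3) * M \<le> (int k - 3) * (M * (M - 1))"
      unfolding vV kK V_def K_def by (simp add: algebra_simps power2_eq_square power3_eq_cube)
    show "(int v - 2) * (M * (M - 1)) \<le> (int k - 2) * (V - 2)"
      unfolding vV kK V_def K_def by (simp add: algebra_simps power2_eq_square power3_eq_cube)
  qed (use y4 y5 vV kK in auto)
  moreover have "y5 + M * (M - 4) - 11 < b"
  proof -
    have "0 < K * (K - 1) + 2"
      unfolding K_def M by (simp add: algebra_simps power2_eq_square add_pos_nonneg)
    then show ?thesis using gap size by (metis less_le_trans mult_less_cancel_right_pos)
  qed
  ultimately show ?thesis by linarith
qed

theorem lemma7:
  fixes m v k :: nat
  assumes "m \<ge> 6"
    and "v = m\<^sup>2 * (m - 2) + 4"
    and "k = m * (m - 1) + 2"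
  shows "int (covering_number v k 5) \<ge> schonheim_bound v k 5 + int m * (int m - 4) - 10"
proof -
  obtain j where j: "m = j + 6" using \<open>m \<ge> 6\<close> by (metis add.commute le_Suc_ex)
  have range: "5 \<le> k" "k \<le> v"
    using assms(2,3) unfolding j by (auto simp: algebra_simps power2_eq_square)
  obtain U :: "nat set" and B
    where cov: "is_covering 5 v k U B" and b: "size B = covering_number v k 5"
    using covering_number_attained[of 5 k v] range by auto
  define b where "b = int (covering_number v k 5)"
  define V where "V = int m ^ 3 - 2 * (int m)\<^sup>2 + 4"
  define K where "K = (int m)\<^sup>2 - int m + 2"
  have vV: "int v = V" and kK: "int k = K"
    unfolding assms(2,3) V_def K_def j
    by (auto simp: algebra_simps power2_eq_square power3_eq_cube)
  have "v * (v - 1) * (v - 1) \<le> size B * (k * (k - 1) + 2)"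
    using covering_size_bound[OF _ assms(2,3) cov] assms(1) by simp
  then have "int (v * (v - 1) * (v - 1)) \<le> int (size B * (k * (k - 1) + 2))"
    by (simp only: of_nat_le_iff)
  then have size: "V * (V - 1)\<^sup>2 \<le> b * (K * (K - 1) + 2)"
    using range vV kK b
    by (simp add: b_def of_nat_diff power2_eq_square mult.assoc distrib_left del: of_nat_mult)
      (simp add: of_nat_diff)
  have reduce: "schonheim_bound v k 5 + int m * (int m - 4) - 10 \<le> b"
    if "(V - 1) * (V - 2) \<le> (K - 1) * y4" "V * y4 \<le> K * y5"
      "(y5 + int m * (int m - 4) - 11) * (K * (K - 1) + 2) < V * (V - 1)\<^sup>2" for y4 y5
    using size_exceeds_schonheim_bound[OF _ assms(2,3), of b y4 y5] assms(1) size that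
    unfolding V_def K_def by simp
  have "m \<in> {6, 7, 8, 9, 10, 11, 12, 13} \<or> m \<ge> 14" using assms(1) by auto
  then consider "m = 6" | "m = 7" | "m = 8" | "m = 9" | "m = 10" | "m = 11" | "m = 12"
    | "m = 13" | "m \<ge> 14" by blast
  then have "schonheim_bound v k 5 + int m * (int m - 4) - 10 \<le> b"
  proof cases
    \<comment> \<open>For \<open>m \<le> 13\<close> the witnesses are the values of the two ceilings.\<close>
    case 1
    then show ?thesis
      by (intro reduce[where ?y4.0 = 693 and ?y5.0 = 3206]) (simp_all add: V_def K_def)
  next
    case 2
    then show ?thesis
      by (intro reduce[where ?y4.0 = 1425 and ?y5.0 = 8065]) (simp_all add: V_def K_def)
  next
    case 3
    then show ?thesis
      by (intro reduce[where ?y4.0 = 2621 and ?y5.0 = 17534]) (simp_all add: V_def K_def)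
  next
    case 4
    then show ?thesis
      by (intro reduce[where ?y4.0 = 4443 and ?y5.0 = 34284]) (simp_all add: V_def K_def)
  next
    case 5
    then show ?thesis
      by (intro reduce[where ?y4.0 = 7077 and ?y5.0 = 61847]) (simp_all add: V_def K_def)
  next
    case 6
    then show ?thesis
      by (intro reduce[where ?y4.0 = 10734 and ?y5.0 = 104753]) (simp_all add: V_def K_def)
  next
    case 7
    then show ?thesis
      by (intro reduce[where ?y4.0 = 15646 and ?y5.0 = 168604]) (simp_all add: V_def K_def)
  next
    case 8
    then show ?thesis
      by (intro reduce[where ?y4.0 = 22072 and ?y5.0 = 260255]) (simp_all add: V_def K_def)
  next
    case 9
    define i where "i = int m - 14"
    have m: "int m = i + 14" and i: "i \<ge> 0" using 9 by (auto simp: i_def)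
    \<comment> \<open>The two quotients are rounded up by \<open>10 m - 8\<close> parts in \<open>k - 1\<close> and by
      \<open>m\<^sup>2 - 7 m - 82\<close> parts in \<open>k\<close>. The polynomials are the exact results of the division;
      the second remainder is negative for \<open>m = 13\<close> and nonnegative from \<open>m = 14\<close> on.\<close>
    define y4 where "y4 = int m ^ 4 - 3 * int m ^ 3 + 8 * int m - 2"
    define y5 where "y5 = int m ^ 5 - 4 * int m ^ 4 + 20 * int m ^ 2 - 10 * int m - 45"
    show ?thesis
    proof (rule reduce)
      have "(K - 1) * y4 - (V - 1) * (V - 2) = 10 * int m - 8"
        unfolding V_def K_def y4_def by (simp add: algebra_simps eval_nat_numeral)
      then show "(V - 1) * (V - 2) \<le> (K - 1) * y4"
        using 9 by linarith
      have "K * y5 - V * y4 = (int m)\<^sup>2 - 7 * int m - 82"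
        unfolding V_def K_def y4_def y5_def by (simp add: algebra_simps eval_nat_numeral)
      also have "\<dots> = i\<^sup>2 + 21 * i + 16"
        unfolding m by (simp add: algebra_simps power2_eq_square)
      finally show "V * y4 \<le> K * y5"
        using i zero_le_power2[of i] by linarith
      have "V * (V - 1)\<^sup>2 - (y5 + int m * (int m - 4) - 11) * (K * (K - 1) + 2) =
          40 * int m ^ 3 + 32 * (int m)\<^sup>2 - 112 * int m + 260"
        unfolding V_def K_def y5_def by (simp add: algebra_simps eval_nat_numeral)
      also have "\<dots> = 40 * i ^ 3 + 1712 * i\<^sup>2 + 24304 * i + 114724"
        unfolding m by (simp add: algebra_simps eval_nat_numeral)
      finally show "(y5 + int m * (int m - 4) - 11) * (K * (K - 1) + 2) < V * (V - 1)\<^sup>2"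
        using i zero_le_power[of i 3] zero_le_power2[of i] by linarith
    qed
  qed
  then show ?thesis by (simp add: b_def)
qed

end
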